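(* Let $\mathbb{F}$ be an infinite field of characteristic $p\neq 2$ ($p=0$ allowed). The following set is an $\mathbb{F}$-basis of the space of all polynomial identities for $\mathsf{A}_1^{(-,1)}$ of multidegree $(1,1,1,1)$ (in the variables $x_1,x_2,x_3,x_4$): $$\Gamma,\; \Phi_{\rm lin}, \; x_1\mathrm{St}_3(x_2,x_3,x_4), \; x_2\mathrm{St}_3(x_1,x_3,x_4), \; x_3\mathrm{St}_3(x_1,x_2,x_4), \; x_4\mathrm{St}_3(x_1,x_2,x_3),$$ $$\mathrm{St}_3(x_2,x_3,x_4)x_1,\; \mathrm{St}_3(x_1,x_3,x_4)x_2,\; \mathrm{St}_3(x_1,x_2,x_4)x_3.$$
   Context: $\mathbb{F}\langle X\rangle$ is the free unital associative $\mathbb{F}$-algebra on $X=\{x_1,x_2,\dots\}$. The Weyl algebra $\mathsf{A}_1$ is the unital associative $\mathbb{F}$-algebra generated by $x,y$ with defining relation $yx=xy+1$, and $\mathsf{A}_1^{(-,1)}\subset\mathsf{A}_1$ is the $\mathbb{F}$-linear span of all elements $ay$ with $a\in\mathbb{F}[x]$. An element $f(x_1,\dots,x_m)\in\mathbb{F}\langle X\rangle$ is a polynomial identity for a subspace $\mathcal{V}$ of an associative algebra $\mathcal{A}$ if $f(a_1,\dots,a_m)=0$ in $\mathcal{A}$ for all $a_1,\dots,a_m\in\mathcal{V}$. An element of multidegree $(1,1,1,1)$ is a linear combination of the monomials $x_{\sigma(1)}x_{\sigma(2)}x_{\sigma(3)}x_{\sigma(4)}$, $\sigma\in S_4$. The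 standard polynomial is $\mathrm{St}_3(z_1,z_2,z_3)=\sum_{\sigma\in S_3}(-1)^{\sigma}z_{\sigma(1)}z_{\sigma(2)}z_{\sigma(3)}$. Let $\Phi_{22}(x_1,x_2)= x_1^2 x_2^2 - 3 x_1 x_2 x_1 x_2 + 2 x_1 x_2^2 x_1 + 2 x_2 x_1^2 x_2 - 3 x_2 x_1 x_2 x_1 + x_2^2 x_1^2$; then $\Phi_{\rm lin}$ is its complete linearization, i.e. the component of multidegree $(1,1,1,1)$ in $x_1,x_2,x_3,x_4$ of $\Phi_{22}(x_1+x_2,\,x_3+x_4)$. Finally $$\begin{aligned}\Gamma={}& -x_1 x_2 x_3 x_4 + 2 x_1 x_2 x_4 x_3 + x_1 x_3 x_4 x_2 - 2 x_1 x_4 x_2 x_3\\ & + 2 x_2 x_1 x_3 x_4 - 2 x_2 x_1 x_4 x_3 - 2 x_2 x_3 x_1 x_4 + x_2 x_3 x_4 x_1 + x_2 x_4 x_1 x_3\\ & + x_3 x_1 x_2 x_4 - 2 x_3 x_1 x_4 x_2 + x_3 x_4 x_1 x_2 + x_4 x_1 x_2 x_3 - x_4 x_2 x_3 x_1.\end{aligned}$$ *)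

theory Defs
  imports
    "HOL-Library.Poly_Mapping"
    "HOL-Computational_Algebra.Polynomial"
    "HOL-Combinatorics.Permutations"
begin

section \<open>Free associative algebras\<close>

text \<open>
  The free unital associative algebra on a set of generators is the monoid algebra of the free
  monoid of words. The wrapper type \<open>'x word\<close> makes concatenation available as the
  addition of a \<^class>\<open>monoid_add\<close>, so that the convolution product of
  \<open>HOL-Library.Poly_Mapping\<close> is the product of the free algebra and
  \<^class>\<open>ring_1\<close> is inherited from there.
\<close>

datatype 'x word = Word (letters: "'x list")

instantiation word :: (type) monoid_add
begin

definition zero_word :: "'a word" where "zero_word = Word []"

definition plus_word :: "'a word \<Rightarrow> 'a word \<Rightarrow> 'a word" where
  "plus_word u v = Word (letters u @ letters v)"

instance
  by standard (simp_all add: zero_word_def plus_word_def)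

end

type_synonym ('x, 'f) free_alg = "'x word \<Rightarrow>\<^sub>0 'f"

definition var :: "'x \<Rightarrow> ('x, 'f::field) free_alg" where
  "var x = Poly_Mapping.single (Word [x]) 1"

definition fa_scale :: "'f \<Rightarrow> ('x, 'f::field) free_alg \<Rightarrow> ('x, 'f) free_alg" where
  "fa_scale c f = Poly_Mapping.map ((*) c) f"

lemma lookup_fa_scale [simp]:
  "Poly_Mapping.lookup (fa_scale c f) w = c * Poly_Mapping.lookup f w"
  unfolding fa_scale_def by (simp add: Poly_Mapping.map.rep_eq when_def)

global_interpretation fa: vector_space "fa_scale :: 'f::field \<Rightarrow> ('x, 'f) free_alg \<Rightarrow> _"
  by standard (rule poly_mapping_eqI; simp add: lookup_add algebra_simps)+

lemma fa_scale_conv_mult: "fa_scale c f = Poly_Mapping.single 0 c * f"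
  unfolding fa_scale_def by (rule mult_map_scale_conv_mult)

text \<open>
  The image of \<open>f\<close> under the unital algebra homomorphism sending each generator
  \<open>x\<close> to \<open>a x\<close>, where \<open>sc\<close> is the scalar multiplication of
  the target algebra.
\<close>

definition eval_at :: "('f \<Rightarrow> 'a \<Rightarrow> 'a) \<Rightarrow> ('x \<Rightarrow> 'a) \<Rightarrow> ('x, 'f::field) free_alg \<Rightarrow> 'a::ring_1" where
  "eval_at sc a f =
     (\<Sum>w\<in>Poly_Mapping.keys f. sc (Poly_Mapping.lookup f w) (prod_list (map a (letters w))))"

definition poly_identity ::
    "('f \<Rightarrow> 'a \<Rightarrow> 'a) \<Rightarrow> 'a::ring_1 set \<Rightarrow> ('x, 'f::field) free_alg \<Rightarrow> bool" where
  "poly_identity sc V f \<longleftrightarrow> (\<forall>a. (\<forall>x. a x \<in> V) \<longrightarrow> eval_at sc a f = 0)"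

definition multidegree_component ::
    "('x \<Rightarrow> nat) \<Rightarrow> ('x, 'f::field) free_alg \<Rightarrow> ('x, 'f) free_alg" where
  "multidegree_component d f =
     (\<Sum>w | w \<in> Poly_Mapping.keys f \<and> count_list (letters w) = d.
        Poly_Mapping.single w (Poly_Mapping.lookup f w))"

inductive_set two_sided_ideal :: "'a::ring_1 set \<Rightarrow> 'a set" for S where
  zero: "0 \<in> two_sided_ideal S"
| base: "s \<in> S \<Longrightarrow> a * s * b \<in> two_sided_ideal S"
| add: "u \<in> two_sided_ideal S \<Longrightarrow> v \<in> two_sided_ideal S \<Longrightarrow> u + v \<in> two_sided_ideal S"

lemma two_sided_ideal_mult_left: "u \<in> two_sided_ideal S \<Longrightarrow> c * u \<in> two_sided_ideal S"
proof (induction rule: two_sided_ideal.induct)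
  case (base s a b)
  then show ?case
    using two_sided_ideal.base[of s S "c * a" b] by (simp add: mult.assoc)
qed (auto simp: distrib_left intro: two_sided_ideal.intros)

lemma two_sided_ideal_mult_right: "u \<in> two_sided_ideal S \<Longrightarrow> u * c \<in> two_sided_ideal S"
proof (induction rule: two_sided_ideal.induct)
  case (base s a b)
  then show ?case
    using two_sided_ideal.base[of s S a "b * c"] by (simp add: mult.assoc)
qed (auto simp: distrib_right intro: two_sided_ideal.intros)

lemma two_sided_ideal_uminus: "u \<in> two_sided_ideal S \<Longrightarrow> - u \<in> two_sided_ideal S"
  using two_sided_ideal_mult_left[of u S "-1"] by simp

lemma two_sided_ideal_diff:
  "u \<in> two_sided_ideal S \<Longrightarrow> v \<in> two_sided_ideal S \<Longrightarrow> u - v \<in> two_sided_ideal S"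
  using two_sided_ideal.add[of u S "- v"] two_sided_ideal_uminus[of v S] by simp


section \<open>The Weyl algebra\<close>

datatype weyl_gen = Gx | Gy

definition weyl_relator :: "(weyl_gen, 'f::field) free_alg" where
  "weyl_relator = var Gy * var Gx - (var Gx * var Gy + 1)"

definition weyl_ideal :: "(weyl_gen, 'f::field) free_alg set" where
  "weyl_ideal = two_sided_ideal {weyl_relator}"

definition weyl_rel :: "(weyl_gen, 'f::field) free_alg \<Rightarrow> (weyl_gen, 'f) free_alg \<Rightarrow> bool" where
  "weyl_rel f g \<longleftrightarrow> f - g \<in> weyl_ideal"

lemma equivp_weyl_rel: "equivp (weyl_rel :: (weyl_gen, 'f::field) free_alg \<Rightarrow> _)"
proof (rule equivpI)
  show "reflp (weyl_rel :: (weyl_gen, 'f) free_alg \<Rightarrow> _)"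
    by (auto simp: reflp_def weyl_rel_def weyl_ideal_def two_sided_ideal.zero)
  show "symp (weyl_rel :: (weyl_gen, 'f) free_alg \<Rightarrow> _)"
    unfolding symp_def weyl_rel_def weyl_ideal_def
    by (metis minus_diff_eq two_sided_ideal_uminus)
  show "transp (weyl_rel :: (weyl_gen, 'f) free_alg \<Rightarrow> _)"
    unfolding transp_def weyl_rel_def weyl_ideal_def
  proof (intro allI impI)
    fix f g h :: "(weyl_gen, 'f) free_alg"
    assume "f - g \<in> two_sided_ideal {weyl_relator}" "g - h \<in> two_sided_ideal {weyl_relator}"
    then have "(f - g) + (g - h) \<in> two_sided_ideal {weyl_relator}"
      by (rule two_sided_ideal.add)
    then show "f - h \<in> two_sided_ideal {weyl_relator}" by simp
  qed
qed

text \<open>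
  The action of the free algebra on \<open>'f poly\<close> by multiplication with the variable and
  by differentiation. It is only needed to see that the quotient below is not the zero ring.
\<close>

fun gen_act :: "weyl_gen \<Rightarrow> 'f::field poly \<Rightarrow> 'f poly" where
  "gen_act Gx q = pCons 0 q"
| "gen_act Gy q = pderiv q"

definition word_act :: "weyl_gen word \<Rightarrow> 'f::field poly \<Rightarrow> 'f poly" where
  "word_act w = foldr gen_act (letters w)"

definition weyl_act :: "(weyl_gen, 'f::field) free_alg \<Rightarrow> 'f poly \<Rightarrow> 'f poly" where
  "weyl_act f q = (\<Sum>w\<in>Poly_Mapping.keys f. smult (Poly_Mapping.lookup f w) (word_act w q))"

lemma gen_act_add: "gen_act g (p + q) = gen_act g p + gen_act g q"
  by (cases g) (auto simp: pderiv_add)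

lemma gen_act_smult: "gen_act g (smult c q) = smult c (gen_act g q)"
  by (cases g) (auto simp: pderiv_smult)

lemma word_act_add: "word_act w (p + q) = word_act w p + word_act w q"
proof -
  have "foldr gen_act ws (p + q) = foldr gen_act ws p + foldr gen_act ws q" for ws
    by (induction ws) (simp_all add: gen_act_add)
  then show ?thesis by (simp add: word_act_def)
qed

lemma word_act_smult: "word_act w (smult c q) = smult c (word_act w q)"
proof -
  have "foldr gen_act ws (smult c q) = smult c (foldr gen_act ws q)" for ws
    by (induction ws) (simp_all add: gen_act_smult)
  then show ?thesis by (simp add: word_act_def)
qed

lemma word_act_plus: "word_act (u + v) q = word_act u (word_act v q)"
  by (simp add: word_act_def plus_word_def)

lemma weyl_act_superset:
  assumes "finite A" "Poly_Mapping.keys f \<subseteq> A"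
  shows "weyl_act f q = (\<Sum>w\<in>A. smult (Poly_Mapping.lookup f w) (word_act w q))"
  unfolding weyl_act_def
  by (rule sum.mono_neutral_left) (use assms in \<open>auto simp: in_keys_iff\<close>)

lemma weyl_act_add: "weyl_act (f + g) q = weyl_act f q + weyl_act g q"
proof -
  let ?A = "Poly_Mapping.keys f \<union> Poly_Mapping.keys g"
  have "Poly_Mapping.keys (f + g) \<subseteq> ?A" by (rule Poly_Mapping.keys_add)
  then show ?thesis
    by (simp add: weyl_act_superset[of ?A] lookup_add smult_add_left sum.distrib)
qed

lemma weyl_act_zero [simp]: "weyl_act 0 q = 0"
  by (simp add: weyl_act_def)

lemma weyl_act_single: "weyl_act (Poly_Mapping.single w c) q = smult c (word_act w q)"
  by (subst weyl_act_superset[of "{w}"]) auto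

lemma weyl_act_add_arg: "weyl_act f (p + q) = weyl_act f p + weyl_act f q"
  by (simp add: weyl_act_def word_act_add smult_add_right sum.distrib)

lemma free_alg_induct [case_names zero single_add]:
  fixes f :: "('x, 'f::field) free_alg"
  assumes "P 0" and "\<And>w c f. P f \<Longrightarrow> P (Poly_Mapping.single w c + f)"
  shows "P f"
proof (induction f rule: update_induct)
  case const
  then show ?case using assms(1) by simp
next
  case (update f w c)
  have "Poly_Mapping.update w c f = Poly_Mapping.single w c + f"
    using update.hyps
    by (intro poly_mapping_eqI)
       (auto simp: lookup_add lookup_update lookup_single when_def in_keys_iff)
  then show ?case using assms(2)[OF update.IH] by simp
qed

lemma weyl_act_mult: "weyl_act (f * g) q = weyl_act f (weyl_act g q)"
proof (induction f rule: free_alg_induct)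
  case (single_add u c f)
  have "weyl_act (Poly_Mapping.single u c * g) q = smult c (word_act u (weyl_act g q))"
  proof (induction g rule: free_alg_induct)
    case zero
    show ?case using word_act_smult[of u 0 0] by (metis mult_zero_right smult_0_left smult_0_right weyl_act_zero)
  next
    case (single_add v d g)
    then show ?case
      by (simp add: distrib_left weyl_act_add weyl_act_single mult_single word_act_plus
          word_act_add word_act_smult smult_add_right)
  qed
  then show ?case
    by (simp add: distrib_right weyl_act_add weyl_act_single single_add)
qed simp

lemma weyl_act_one [simp]: "weyl_act 1 q = q"
  unfolding single_one[symmetric] weyl_act_single
  by (simp add: word_act_def zero_word_def)

lemma weyl_act_zero_arg [simp]: "weyl_act f (0 :: 'a::field poly) = 0"
proof -
  have "word_act w (0 :: 'a poly) = 0" for w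
    using word_act_smult[of w 0 "0 :: 'a poly"] by simp
  then show ?thesis by (simp add: weyl_act_def)
qed

lemma weyl_act_relator: "weyl_act weyl_relator q = 0"
proof -
  have "weyl_relator + (var Gx * var Gy + 1) = var Gy * var Gx"
    by (simp add: weyl_relator_def)
  then have "weyl_act weyl_relator q + weyl_act (var Gx * var Gy + 1) q
      = weyl_act (var Gy * var Gx) q"
    by (metis weyl_act_add)
  then show ?thesis
    by (simp add: weyl_act_add weyl_act_mult var_def weyl_act_single word_act_def pderiv_pCons)
qed

lemma weyl_act_ideal: "f \<in> weyl_ideal \<Longrightarrow> weyl_act f q = 0"
  unfolding weyl_ideal_def
  by (induction rule: two_sided_ideal.induct)
     (auto simp: weyl_act_mult weyl_act_add weyl_act_relator)

lemma one_notin_weyl_ideal: "1 \<notin> weyl_ideal"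
  using weyl_act_ideal[of 1 1] by auto

quotient_type (overloaded) 'f weyl = "(weyl_gen, 'f::field) free_alg" / weyl_rel
  by (rule equivp_weyl_rel)

instantiation weyl :: (field) ring_1
begin

lift_definition zero_weyl :: "'a weyl" is 0 .

lift_definition one_weyl :: "'a weyl" is 1 .

lift_definition plus_weyl :: "'a weyl \<Rightarrow> 'a weyl \<Rightarrow> 'a weyl" is "(+)"
  unfolding weyl_rel_def weyl_ideal_def by (metis add_diff_add two_sided_ideal.add)

lift_definition uminus_weyl :: "'a weyl \<Rightarrow> 'a weyl" is uminus
  unfolding weyl_rel_def weyl_ideal_def by (metis minus_diff_minus two_sided_ideal_uminus)

lift_definition minus_weyl :: "'a weyl \<Rightarrow> 'a weyl \<Rightarrow> 'a weyl" is "(-)"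
proof -
  fix f f' g g' :: "(weyl_gen, 'a) free_alg"
  assume "weyl_rel f f'" "weyl_rel g g'"
  moreover have "f - g - (f' - g') = (f - f') - (g - g')" by simp
  ultimately show "weyl_rel (f - g) (f' - g')"
    unfolding weyl_rel_def weyl_ideal_def by (metis two_sided_ideal_diff)
qed

lift_definition times_weyl :: "'a weyl \<Rightarrow> 'a weyl \<Rightarrow> 'a weyl" is "(*)"
proof -
  fix f f' g g' :: "(weyl_gen, 'a) free_alg"
  assume "weyl_rel f f'" "weyl_rel g g'"
  moreover have "f * g - f' * g' = (f - f') * g + f' * (g - g')" by (simp add: algebra_simps)
  ultimately show "weyl_rel (f * g) (f' * g')"
    unfolding weyl_rel_def weyl_ideal_def
    by (metis two_sided_ideal.add two_sided_ideal_mult_left two_sided_ideal_mult_right)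
qed

instance
proof
  show "(0 :: 'a weyl) \<noteq> 1"
  proof (transfer, unfold weyl_rel_def, rule notI)
    assume "0 - 1 \<in> (weyl_ideal :: (weyl_gen, 'a) free_alg set)"
    then have "- (0 - 1) \<in> (weyl_ideal :: (weyl_gen, 'a) free_alg set)"
      unfolding weyl_ideal_def by (rule two_sided_ideal_uminus)
    then show False by (simp add: one_notin_weyl_ideal)
  qed
qed (transfer; simp add: algebra_simps weyl_rel_def weyl_ideal_def two_sided_ideal.zero)+

end

lift_definition weyl_scale :: "'f::field \<Rightarrow> 'f weyl \<Rightarrow> 'f weyl" is fa_scale
proof -
  fix c and f g :: "(weyl_gen, 'f) free_alg"
  assume "weyl_rel f g"
  then show "weyl_rel (fa_scale c f) (fa_scale c g)"
    unfolding weyl_rel_def weyl_ideal_def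
    by (metis fa.scale_right_diff_distrib fa_scale_conv_mult two_sided_ideal_mult_left)
qed

global_interpretation weyl: vector_space "weyl_scale :: 'f::field \<Rightarrow> 'f weyl \<Rightarrow> 'f weyl"
  by standard
     (transfer; simp add: fa.scale_left_distrib fa.scale_right_distrib weyl_rel_def
        weyl_ideal_def two_sided_ideal.zero)+

lift_definition weyl_x :: "'f::field weyl" is "var Gx" .

lift_definition weyl_y :: "'f::field weyl" is "var Gy" .

lemma weyl_commutation: "weyl_y * weyl_x = weyl_x * weyl_y + (1 :: 'f::field weyl)"
proof (transfer, unfold weyl_rel_def)
  show "var Gy * var Gx - (var Gx * var Gy + 1) \<in> (weyl_ideal :: (weyl_gen, 'f) free_alg set)"
    using two_sided_ideal.base[of weyl_relator "{weyl_relator}" 1 1]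
    by (simp add: weyl_ideal_def weyl_relator_def)
qed

definition weyl_of_poly :: "'f::field poly \<Rightarrow> 'f weyl" where
  "weyl_of_poly p = (\<Sum>i\<le>degree p. weyl_scale (coeff p i) (weyl_x ^ i))"

text \<open>The space denoted \<open>A\<^sub>1\<^sup>(\<^sup>-\<^sup>,\<^sup>1\<^sup>)\<close>: the span of all \<open>a y\<close> with \<open>a\<close> a polynomial in \<open>x\<close>.\<close>

definition weyl_minus_one :: "'f::field weyl set" where
  "weyl_minus_one = weyl.span {weyl_of_poly p * weyl_y | p. True}"


section \<open>Multilinear elements of degree four\<close>

text \<open>
  The variables are indexed by \<open>nat\<close>; \<open>x\<^sub>i\<close> is \<open>var i\<close>. The additional
  variable \<open>var 0\<close> never occurs in elements of the multidegree considered.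
\<close>

definition multilinear4 :: "(nat, 'f::field) free_alg set" where
  "multilinear4 =
     fa.span {var (\<sigma> 1) * var (\<sigma> 2) * var (\<sigma> 3) * var (\<sigma> 4) | \<sigma>. \<sigma> permutes {1, 2, 3, 4::nat}}"

definition St3 :: "'a::ring_1 \<Rightarrow> 'a \<Rightarrow> 'a \<Rightarrow> 'a" where
  "St3 z1 z2 z3 =
     (\<Sum>\<sigma> | \<sigma> permutes {..<3}.
        of_int (sign \<sigma>) * ([z1, z2, z3] ! \<sigma> 0 * [z1, z2, z3] ! \<sigma> 1 * [z1, z2, z3] ! \<sigma> 2))"

definition Phi22 :: "'a::ring_1 \<Rightarrow> 'a \<Rightarrow> 'a" where
  "Phi22 x1 x2 =
     x1^2 * x2^2 - 3 * (x1 * x2 * x1 * x2) + 2 * (x1 * x2^2 * x1)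
     + 2 * (x2 * x1^2 * x2) - 3 * (x2 * x1 * x2 * x1) + x2^2 * x1^2"

definition Phi_lin :: "(nat, 'f::field) free_alg" where
  "Phi_lin =
     multidegree_component (\<lambda>i. if i \<in> {1, 2, 3, 4} then 1 else 0)
       (Phi22 (var 1 + var 2) (var 3 + var 4))"

definition Gamma_poly :: "(nat, 'f::field) free_alg" where
  "Gamma_poly =
     (let x1 = var 1; x2 = var 2; x3 = var 3; x4 = var 4 in
      - (x1 * x2 * x3 * x4) + 2 * (x1 * x2 * x4 * x3) + x1 * x3 * x4 * x2 - 2 * (x1 * x4 * x2 * x3)
      + 2 * (x2 * x1 * x3 * x4) - 2 * (x2 * x1 * x4 * x3) - 2 * (x2 * x3 * x1 * x4)
      + x2 * x3 * x4 * x1 + x2 * x4 * x1 * x3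
      + x3 * x1 * x2 * x4 - 2 * (x3 * x1 * x4 * x2) + x3 * x4 * x1 * x2
      + x4 * x1 * x2 * x3 - x4 * x2 * x3 * x1)"

end

theory Submission
  imports Defs "HOL-Combinatorics.Multiset_Permutations"
begin

text \<open>
  A product of elements \<open>p y\<close> has a normal form \<open>\<Sum> c\<^sub>k y\<^sup>k\<close> in which the \<open>c\<^sub>k\<close> are
  differential polynomials in the factors \<open>p\<close>; that the nine elements are identities amounts
  to polynomial equations between these coefficients. Conversely, substituting \<open>x^ki y\<close> with
  \<open>ki \<le> 2\<close> for the variables and reading off constant terms gives fifteen linear equations
  for the 24 coefficients of a multilinear identity. They have rank 15 in every characteristic
  different from 2, and nine words can be chosen at which the nine elements have an invertible
  coefficient matrix while an identity vanishing at all of them is zero.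
\<close>

section \<open>Evaluation is an algebra homomorphism\<close>

text \<open>A vector space structure on a ring does not relate scalars to products; the two laws
  make scalars central. Evaluation is used with two targets: the Weyl algebra for the identities,
  the free algebra for the shift of \<open>y\<close>.\<close>

locale unital_algebra = vector_space sc
  for sc :: "'f::field \<Rightarrow> 'a::ring_1 \<Rightarrow> 'a" +
  assumes scale_mult_left: "sc c a * b = sc c (a * b)"
    and scale_mult_right: "a * sc c b = sc c (a * b)"
begin

lemma eval_at_superset:
  assumes "finite A" "Poly_Mapping.keys f \<subseteq> A"
  shows "eval_at sc a f = (\<Sum>w\<in>A. sc (Poly_Mapping.lookup f w) (prod_list (map a (letters w))))"
  unfolding eval_at_def
  by (rule sum.mono_neutral_left) (use assms in \<open>auto simp: in_keys_iff\<close>)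

lemma eval_at_zero: "eval_at sc a 0 = 0"
  by (simp add: eval_at_def)

lemma eval_at_add: "eval_at sc a (f + g) = eval_at sc a f + eval_at sc a g"
proof -
  let ?A = "Poly_Mapping.keys f \<union> Poly_Mapping.keys g"
  have "Poly_Mapping.keys (f + g) \<subseteq> ?A" by (rule Poly_Mapping.keys_add)
  then show ?thesis
    by (simp add: eval_at_superset[of ?A] lookup_add scale_left_distrib sum.distrib)
qed

lemma eval_at_single:
  "eval_at sc a (Poly_Mapping.single w c) = sc c (prod_list (map a (letters w)))"
  by (subst eval_at_superset[of "{w}"]) auto

lemma eval_at_var: "eval_at sc a (var x) = a x"
  by (simp add: var_def eval_at_single)

lemma eval_at_one: "eval_at sc a 1 = 1"
  unfolding single_one[symmetric] eval_at_single by (simp add: zero_word_def)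

lemma eval_at_uminus: "eval_at sc a (- f) = - eval_at sc a f"
  using eval_at_add[of a "- f" f] by (simp add: eval_at_zero eq_neg_iff_add_eq_0)

lemma eval_at_diff: "eval_at sc a (f - g) = eval_at sc a f - eval_at sc a g"
  using eval_at_add[of a f "- g"] by (simp add: eval_at_uminus)

lemma eval_at_numeral: "eval_at sc a (numeral n) = numeral n"
  by (induction n) (simp_all only: numeral.simps eval_at_add eval_at_one)

text \<open>Additivity in both arguments reduces this to single words, where concatenation becomes
  multiplication and scalars move out by centrality.\<close>

lemma eval_at_mult: "eval_at sc a (f * g) = eval_at sc a f * eval_at sc a g"
proof (induction f rule: free_alg_induct)
  case (single_add u c f)
  have "eval_at sc a (Poly_Mapping.single u c * g) =
      eval_at sc a (Poly_Mapping.single u c) * eval_at sc a g"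
  proof (induction g rule: free_alg_induct)
    case (single_add v d g)
    then show ?case
      by (simp add: distrib_left eval_at_add eval_at_single mult_single plus_word_def
          scale_mult_left scale_mult_right)
  qed (simp add: eval_at_zero)
  then show ?case
    by (simp add: distrib_right eval_at_add single_add)
qed (simp add: eval_at_zero)

lemma eval_at_scale: "eval_at sc a (fa_scale c f) = sc c (eval_at sc a f)"
  by (simp add: fa_scale_conv_mult eval_at_mult eval_at_single zero_word_def scale_mult_left)

lemmas eval_at_simps =
  eval_at_zero eval_at_one eval_at_var eval_at_numeral eval_at_add eval_at_diff eval_at_uminus
  eval_at_mult

end

lemma fa_scale_mult_left: "fa_scale c f * g = fa_scale c (f * g)"
  by (simp add: fa_scale_conv_mult mult.assoc)

lemma fa_scale_mult_right: "f * fa_scale c g = fa_scale c (f * g)"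
proof -
  have "f * Poly_Mapping.single 0 c = Poly_Mapping.single 0 c * f"
    by (induction f rule: free_alg_induct)
      (simp_all add: distrib_left distrib_right mult_single mult.commute)
  then show ?thesis
    by (simp add: fa_scale_conv_mult mult.assoc[symmetric])
qed

interpretation fa: unital_algebra "fa_scale :: 'f::field \<Rightarrow> ('x, 'f) free_alg \<Rightarrow> _"
  by unfold_locales (simp_all add: fa_scale_mult_left fa_scale_mult_right)

lemma weyl_rel_refl: "weyl_rel f f"
  by (simp add: weyl_rel_def weyl_ideal_def two_sided_ideal.zero)

interpretation weyl: unital_algebra "weyl_scale :: 'f::field \<Rightarrow> 'f weyl \<Rightarrow> _"
proof unfold_locales
  fix c :: 'f and a b :: "'f weyl"
  show "weyl_scale c a * b = weyl_scale c (a * b)"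
    by transfer (simp add: fa_scale_mult_left weyl_rel_refl)
  show "a * weyl_scale c b = weyl_scale c (a * b)"
    by transfer (simp add: fa_scale_mult_right weyl_rel_refl)
qed


section \<open>The polynomial subalgebra of the Weyl algebra\<close>

text \<open>A summation bound detached from the degree lets polynomials be added coefficientwise
  even when leading terms cancel.\<close>

lemma weyl_of_poly_superset:
  assumes "degree p \<le> n"
  shows "weyl_of_poly p = (\<Sum>i\<le>n. weyl_scale (coeff p i) (weyl_x ^ i))"
  unfolding weyl_of_poly_def
  by (rule sum.mono_neutral_left) (use assms in \<open>auto simp: coeff_eq_0\<close>)

lemma weyl_of_poly_0: "weyl_of_poly 0 = 0"
  by (simp add: weyl_of_poly_def)

lemma weyl_of_poly_add: "weyl_of_poly (p + q) = weyl_of_poly p + weyl_of_poly q"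
proof -
  let ?n = "max (degree p) (degree q)"
  show ?thesis
    using degree_add_le_max[of p q]
    by (simp add: weyl_of_poly_superset[of _ ?n] weyl.scale_left_distrib sum.distrib)
qed

lemma weyl_of_poly_smult: "weyl_of_poly (smult c p) = weyl_scale c (weyl_of_poly p)"
  by (simp add: weyl_of_poly_superset[of _ "degree p"] weyl.scale_sum_right degree_smult_le)

lemma weyl_of_poly_pCons: "weyl_of_poly (pCons c p) = weyl_scale c 1 + weyl_x * weyl_of_poly p"
proof -
  have "weyl_of_poly (pCons c p) =
      (\<Sum>i\<le>Suc (degree p). weyl_scale (coeff (pCons c p) i) (weyl_x ^ i))"
    by (rule weyl_of_poly_superset) (rule degree_pCons_le)
  also have "\<dots> = weyl_scale c 1 + (\<Sum>i\<le>degree p. weyl_scale (coeff p i) (weyl_x ^ Suc i))"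
    by (subst sum.atMost_Suc_shift) simp
  also have "\<dots> = weyl_scale c 1 + weyl_x * weyl_of_poly p"
    by (simp add: weyl_of_poly_def sum_distrib_left weyl.scale_mult_right)
  finally show ?thesis .
qed

lemma weyl_of_poly_mult: "weyl_of_poly (p * q) = weyl_of_poly p * weyl_of_poly q"
proof (induction p)
  case (pCons c p)
  then show ?case
    by (simp add: weyl_of_poly_add weyl_of_poly_smult weyl_of_poly_pCons distrib_right
        weyl.scale_mult_left mult.assoc)
qed (simp add: weyl_of_poly_0)

text \<open>The Leibniz rule as a commutation rule: the induction on \<open>p\<close> moves
  \<open>y\<close> past one \<open>x\<close> at a time by the defining relation.\<close>

lemma weyl_y_of_poly:
  "weyl_y * weyl_of_poly p = weyl_of_poly p * weyl_y + weyl_of_poly (pderiv p)"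
proof (induction p)
  case (pCons c p)
  have "weyl_y * weyl_of_poly (pCons c p) =
      weyl_scale c weyl_y + (weyl_y * weyl_x) * weyl_of_poly p"
    by (simp add: weyl_of_poly_pCons distrib_left weyl.scale_mult_right mult.assoc)
  also have "\<dots> = weyl_scale c weyl_y + weyl_x * (weyl_y * weyl_of_poly p) + weyl_of_poly p"
    by (simp add: weyl_commutation distrib_right mult.assoc)
  also have "\<dots> = weyl_of_poly (pCons c p) * weyl_y + weyl_of_poly (pderiv (pCons c p))"
    by (simp add: pCons pderiv_pCons weyl_of_poly_pCons weyl_of_poly_add distrib_left distrib_right
        weyl.scale_mult_left mult.assoc)
  finally show ?case .
qed (simp add: weyl_of_poly_0)

text \<open>Linearity of \<open>weyl_of_poly\<close> makes the generators a subspace already. A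
  substitution from this space is therefore a choice of one polynomial per variable.\<close>

lemma weyl_minus_one_eq: "weyl_minus_one = range (\<lambda>p :: 'f::field poly. weyl_of_poly p * weyl_y)"
proof -
  let ?S = "range (\<lambda>p :: 'f poly. weyl_of_poly p * weyl_y)"
  have "weyl.subspace ?S"
  proof (rule weyl.subspaceI)
    show "0 \<in> ?S"
      by (rule range_eqI[of _ _ 0]) (simp add: weyl_of_poly_0)
    fix u v :: "'f weyl" and c :: 'f
    assume "u \<in> ?S"
    then obtain p where p: "u = weyl_of_poly p * weyl_y" by blast
    show "weyl_scale c u \<in> ?S"
      by (rule range_eqI[of _ _ "smult c p"]) (simp add: p weyl_of_poly_smult weyl.scale_mult_left)
    assume "v \<in> ?S"
    then obtain q where q: "v = weyl_of_poly q * weyl_y" by blast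
    show "u + v \<in> ?S"
      by (rule range_eqI[of _ _ "p + q"]) (simp add: p q weyl_of_poly_add distrib_right)
  qed
  moreover have "{weyl_of_poly p * weyl_y | p. True} = ?S" by auto
  ultimately show ?thesis
    unfolding weyl_minus_one_def by (simp add: weyl.span_eq_iff)
qed

lemma poly_identity_weyl_iff:
  fixes f :: "('x, 'f::field) free_alg"
  shows "poly_identity weyl_scale weyl_minus_one f \<longleftrightarrow>
    (\<forall>P. eval_at weyl_scale (\<lambda>i. weyl_of_poly (P i) * weyl_y) f = 0)"
proof
  assume *: "\<forall>P. eval_at weyl_scale (\<lambda>i. weyl_of_poly (P i) * weyl_y) f = 0"
  show "poly_identity weyl_scale weyl_minus_one f"
    unfolding poly_identity_def
  proof (intro allI impI)
    fix a :: "'x \<Rightarrow> 'f weyl"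
    assume "\<forall>x. a x \<in> weyl_minus_one"
    then have "\<forall>x. \<exists>p. a x = weyl_of_poly p * weyl_y"
      unfolding weyl_minus_one_eq by blast
    then obtain P where "a = (\<lambda>x. weyl_of_poly (P x) * weyl_y)" by metis
    then show "eval_at weyl_scale a f = 0" using * by simp
  qed
qed (auto simp: poly_identity_def weyl_minus_one_eq)


section \<open>A faithful action of the Weyl algebra\<close>

definition shift_y :: "(weyl_gen, 'f::field) free_alg \<Rightarrow> (weyl_gen, 'f) free_alg" where
  "shift_y = eval_at fa_scale (case_weyl_gen (var Gx) (var Gy + 1))"

text \<open>The substitution fixes the relator, since (y+1)x - x(y+1) - 1 = yx - xy - 1, so it
  descends to the quotient.\<close>

lemma shift_y_ideal: "f \<in> weyl_ideal \<Longrightarrow> shift_y f \<in> weyl_ideal"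
  unfolding weyl_ideal_def
proof (induction rule: two_sided_ideal.induct)
  case (base s a b)
  then have "shift_y s = weyl_relator"
    by (simp add: shift_y_def weyl_relator_def fa.eval_at_simps distrib_left distrib_right)
  then have "shift_y (a * s * b) = shift_y a * weyl_relator * shift_y b"
    by (simp add: shift_y_def fa.eval_at_mult)
  then show ?case by (simp add: two_sided_ideal.base)
qed (simp_all add: shift_y_def fa.eval_at_simps two_sided_ideal.zero two_sided_ideal.add)

text \<open>
  Letting \<open>y\<close> act as \<open>d/dx + 1\<close> instead of \<open>d/dx\<close> keeps the powers of \<open>y\<close> visible
  in characteristic 3, where the cube of \<open>d/dx\<close> vanishes.
\<close>

lift_definition weyl_op :: "'f::field weyl \<Rightarrow> 'f poly \<Rightarrow> 'f poly" is "\<lambda>f. weyl_act (shift_y f)"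
proof -
  fix f g :: "(weyl_gen, 'f) free_alg"
  assume "weyl_rel f g"
  then have "shift_y (f - g) \<in> weyl_ideal"
    unfolding weyl_rel_def by (rule shift_y_ideal)
  then have "weyl_act (shift_y (f - g)) q = 0" for q
    by (rule weyl_act_ideal)
  moreover have "weyl_act (shift_y f) q = weyl_act (shift_y (f - g)) q + weyl_act (shift_y g) q" for q
    by (simp add: weyl_act_add[symmetric] shift_y_def fa.eval_at_diff)
  ultimately show "weyl_act (shift_y f) = weyl_act (shift_y g)"
    by (intro ext) simp
qed

lemma weyl_op_zero: "weyl_op 0 q = 0"
  by transfer (simp add: shift_y_def fa.eval_at_zero)

lemma weyl_op_add: "weyl_op (u + v) q = weyl_op u q + weyl_op v q"
  by transfer (simp add: shift_y_def fa.eval_at_add weyl_act_add)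

lemma weyl_op_mult: "weyl_op (u * v) q = weyl_op u (weyl_op v q)"
  by transfer (simp add: shift_y_def fa.eval_at_mult weyl_act_mult)

lemma weyl_op_one: "weyl_op 1 q = q"
  by transfer (simp add: shift_y_def fa.eval_at_one)

lemma weyl_op_scale: "weyl_op (weyl_scale c u) q = smult c (weyl_op u q)"
  by (induction u rule: weyl.abs_induct)
    (simp add: weyl_scale.abs_eq weyl_op.abs_eq shift_y_def fa.eval_at_mult
      fa.eval_at_single fa_scale_conv_mult weyl_act_mult weyl_act_single word_act_def zero_word_def)

lemma weyl_op_sum: "weyl_op (sum u A) q = (\<Sum>i\<in>A. weyl_op (u i) q)"
  by (induction A rule: infinite_finite_induct) (simp_all add: weyl_op_zero weyl_op_add)

lemma weyl_op_x: "weyl_op weyl_x q = pCons 0 q"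
proof -
  have "weyl_act (shift_y (var Gx)) q = pCons 0 q"
    by (simp add: shift_y_def fa.eval_at_var) (simp add: var_def weyl_act_single word_act_def)
  then show ?thesis by (simp add: weyl_op.abs_eq weyl_x_def)
qed

lemma weyl_op_y: "weyl_op weyl_y q = q + pderiv q"
proof -
  have "weyl_act (shift_y (var Gy)) q = weyl_act (var Gy) q + q"
    by (simp add: shift_y_def fa.eval_at_var weyl_act_add)
  then show ?thesis
    by (simp add: weyl_op.abs_eq weyl_y_def var_def weyl_act_single word_act_def)
qed

lemma weyl_op_of_poly: "weyl_op (weyl_of_poly p) q = p * q"
proof (induction p)
  case (pCons c p)
  then show ?case
    by (simp add: weyl_of_poly_pCons weyl_op_add weyl_op_scale weyl_op_mult weyl_op_x weyl_op_one)
qed (simp add: weyl_of_poly_0 weyl_op_zero)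


section \<open>Normal forms\<close>

definition vfield :: "'f::field poly \<Rightarrow> 'f weyl" where
  "vfield p = weyl_of_poly p * weyl_y"

text \<open>There is no slot for y^0 because every factor \<open>p y\<close> ends in
  \<open>y\<close>; four slots suffice for products of at most four factors.\<close>

definition nf :: "'f::field poly \<Rightarrow> 'f poly \<Rightarrow> 'f poly \<Rightarrow> 'f poly \<Rightarrow> 'f weyl" where
  "nf a b c d = weyl_of_poly a * weyl_y ^ 4 + weyl_of_poly b * weyl_y ^ 3
    + weyl_of_poly c * weyl_y ^ 2 + weyl_of_poly d * weyl_y"

lemma vfield_mult_normal:
  "vfield p * (weyl_of_poly c * weyl_y ^ k) =
    weyl_of_poly (p * c) * weyl_y ^ Suc k + weyl_of_poly (p * pderiv c) * weyl_y ^ k"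
proof -
  have "vfield p * (weyl_of_poly c * weyl_y ^ k) =
      weyl_of_poly p * (weyl_y * weyl_of_poly c) * weyl_y ^ k"
    by (simp add: vfield_def mult.assoc)
  then show ?thesis
    by (simp add: weyl_y_of_poly weyl_of_poly_mult distrib_left distrib_right mult.assoc)
qed

lemma vfield_eq_nf: "vfield p = nf 0 0 0 p"
  by (simp add: vfield_def nf_def weyl_of_poly_0)

lemma vfield_mult_nf:
  "vfield p * nf 0 b c d = nf (p * b) (p * pderiv b + p * c) (p * pderiv c + p * d) (p * pderiv d)"
  using vfield_mult_normal[of p b 3] vfield_mult_normal[of p c 2] vfield_mult_normal[of p d 1]
  by (simp add: nf_def weyl_of_poly_0 weyl_of_poly_add distrib_left distrib_right eval_nat_numeral
      add.assoc)

text \<open>Normalisation starts at the innermost three factors. Rewriting with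
  \<open>vfield_eq_nf\<close> everywhere would also turn the left factors into \<open>nf\<close>,
  where \<open>vfield_mult_nf\<close> no longer matches.\<close>

lemma vfield_mult3:
  "vfield p * (vfield q * vfield r) = nf 0 (p * (q * r)) (p * pderiv (q * r) + p * (q * pderiv r))
    (p * pderiv (q * pderiv r))"
  by (simp add: vfield_eq_nf[of r] vfield_mult_nf)

lemma nf_uminus: "- nf a b c d = nf (- a) (- b) (- c) (- d)"
proof -
  have "- weyl_of_poly p = weyl_of_poly (- p)" for p :: "'a poly"
    using weyl_of_poly_add[of p "- p"] by (simp add: weyl_of_poly_0 neg_eq_iff_add_eq_0)
  then show ?thesis by (simp add: nf_def minus_mult_left)
qed

lemma nf_add: "nf a b c d + nf a' b' c' d' = nf (a + a') (b + b') (c + c') (d + d')"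
  by (simp add: nf_def weyl_of_poly_add distrib_right)

lemma nf_diff: "nf a b c d - nf a' b' c' d' = nf (a - a') (b - b') (c - c') (d - d')"
  using nf_add[of a b c d "- a'" "- b'" "- c'" "- d'"] by (simp add: nf_uminus[symmetric])

lemma nf_numeral:
  "numeral n * nf a b c d = nf (numeral n * a) (numeral n * b) (numeral n * c) (numeral n * d)"
proof (induction n)
  case (Bit0 n)
  then show ?case by (simp only: numeral.simps distrib_right nf_add)
next
  case (Bit1 n)
  then show ?case by (simp only: numeral.simps distrib_right nf_add mult_1_left)
qed simp

lemma nf_eq_0: "a = 0 \<Longrightarrow> b = 0 \<Longrightarrow> c = 0 \<Longrightarrow> d = 0 \<Longrightarrow> nf a b c d = 0"
  by (simp add: nf_def weyl_of_poly_0)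

lemmas nf_simps = vfield_mult3 vfield_mult_nf nf_uminus nf_add nf_diff nf_numeral

text \<open>The sum over permutations unfolds by inserting 0 and then 1 into {2}: each permutation
  is a transposition composed with a permutation of the smaller set.\<close>

lemma St3_expand:
  "St3 a b c = a * b * c - a * c * b - b * a * c + b * c * a + c * a * b - c * b * a"
proof -
  have 0: "{..<3::nat} = {0, 1, 2}" by auto
  have f1: "finite {1::nat, 2}" "0 \<notin> {1::nat, 2}" and f2: "finite {2::nat}" "1 \<notin> {2::nat}"
    by auto
  show ?thesis
    unfolding St3_def 0 sum_over_permutations_insert[OF f1] sum_over_permutations_insert[OF f2]
      permutes_sing
    by (simp add: sign_swap_id permutation_swap_id sign_compose sign_id algebra_simps
        transpose_def numeral_2_eq_2)
qed


section \<open>Closure properties of the set of identities\<close>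

lemma poly_identity_vfield_iff:
  "poly_identity weyl_scale weyl_minus_one f \<longleftrightarrow> (\<forall>P. eval_at weyl_scale (\<lambda>i. vfield (P i)) f = 0)"
  by (simp add: poly_identity_weyl_iff vfield_def)

lemma poly_identity_zero: "poly_identity weyl_scale weyl_minus_one 0"
  by (simp add: poly_identity_def weyl.eval_at_zero)

lemma poly_identity_add:
  "poly_identity weyl_scale weyl_minus_one f \<Longrightarrow> poly_identity weyl_scale weyl_minus_one g \<Longrightarrow>
    poly_identity weyl_scale weyl_minus_one (f + g)"
  by (simp add: poly_identity_def weyl.eval_at_add)

lemma poly_identity_scale:
  "poly_identity weyl_scale weyl_minus_one f \<Longrightarrow>
    poly_identity weyl_scale weyl_minus_one (fa_scale c f)"
  by (simp add: poly_identity_def weyl.eval_at_scale)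

lemma poly_identity_mult_left:
  "poly_identity weyl_scale weyl_minus_one g \<Longrightarrow> poly_identity weyl_scale weyl_minus_one (f * g)"
  by (simp add: poly_identity_def weyl.eval_at_mult)

lemma poly_identity_mult_right:
  "poly_identity weyl_scale weyl_minus_one f \<Longrightarrow> poly_identity weyl_scale weyl_minus_one (f * g)"
  by (simp add: poly_identity_def weyl.eval_at_mult)

section \<open>Multilinear elements of degree four\<close>

text \<open>Replaces an equality of functions by conditions that the simplifier can evaluate on a
  concrete word.\<close>

lemma count_list_multilinear4_iff:
  "count_list l = (\<lambda>i. if i \<in> {1, 2, 3, 4} then 1 else 0) \<longleftrightarrow>
    count_list l 1 = 1 \<and> count_list l 2 = 1 \<and> count_list l 3 = 1 \<and> count_list l 4 = 1
    \<and> set l \<subseteq> {1, 2, 3, 4 :: nat}" (is "_ = ?d \<longleftrightarrow> ?R")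
proof
  assume *: "count_list l = ?d"
  have "set l \<subseteq> {1, 2, 3, 4}"
  proof
    fix i assume "i \<in> set l"
    then have "count_list l i \<noteq> 0" by (simp add: count_list_0_iff)
    then show "i \<in> {1, 2, 3, 4}" unfolding * by meson
  qed
  then show ?R unfolding * by simp
next
  assume R: ?R
  show "count_list l = ?d"
  proof
    fix i
    show "count_list l i = ?d i"
      using R by (cases "i \<in> {1, 2, 3, 4}") (auto simp: count_list_0_iff)
  qed
qed

section \<open>Components of a given multidegree\<close>

lemma lookup_multidegree_component:
  "Poly_Mapping.lookup (multidegree_component d f) w =
    (if count_list (letters w) = d then Poly_Mapping.lookup f w else 0)"
proof -
  have "finite {w \<in> Poly_Mapping.keys f. count_list (letters w) = d}" by simp
  then have "Poly_Mapping.lookup (multidegree_component d f) w =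
      (if w \<in> {w \<in> Poly_Mapping.keys f. count_list (letters w) = d}
       then Poly_Mapping.lookup f w else 0)"
    unfolding multidegree_component_def lookup_sum lookup_single when_def by (rule sum.delta)
  then show ?thesis by (simp add: in_keys_iff)
qed

lemma var_mult4: "var a * (var b * (var c * var d)) = Poly_Mapping.single (Word [a, b, c, d]) 1"
  by (simp add: var_def mult_single plus_word_def)

lemma multidegree_component_add:
  "multidegree_component d (f + g) = multidegree_component d f + multidegree_component d g"
  by (rule poly_mapping_eqI) (simp add: lookup_multidegree_component lookup_add)

lemma multidegree_component_diff:
  "multidegree_component d (f - g) = multidegree_component d f - multidegree_component d g"
  by (rule poly_mapping_eqI) (simp add: lookup_multidegree_component lookup_minus)

lemma multidegree_component_numeral:
  "multidegree_component d (numeral n * f) = numeral n * multidegree_component d f"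
proof (induction n)
  case (Bit0 n)
  then show ?case by (simp only: numeral.simps distrib_right multidegree_component_add)
next
  case (Bit1 n)
  then show ?case by (simp only: numeral.simps distrib_right multidegree_component_add mult_1_left)
qed simp

lemma multidegree_component_var4:
  "multidegree_component d (var i * (var j * (var k * var l))) =
    (if count_list [i, j, k, l] = d then var i * (var j * (var k * var l)) else 0)"
  by (rule poly_mapping_eqI) (auto simp: lookup_multidegree_component var_mult4 lookup_single when_def)

section \<open>The 24 multilinear words and their span\<close>

lemma permutations_1234:
  "permutations_of_set {1, 2, 3, 4 :: nat} =
    {[4,3,1,2], [4,3,2,1], [4,2,1,3], [4,2,3,1], [4,1,2,3], [4,1,3,2],
     [3,4,1,2], [3,4,2,1], [3,2,1,4], [3,2,4,1], [3,1,2,4], [3,1,4,2],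
     [2,4,1,3], [2,4,3,1], [2,3,1,4], [2,3,4,1], [2,1,3,4], [2,1,4,3],
     [1,4,2,3], [1,4,3,2], [1,3,2,4], [1,3,4,2], [1,2,3,4], [1,2,4,3]}"
proof -
  have 3: "permutations_of_set {a, b, c} = {[c,a,b], [c,b,a], [b,a,c], [b,c,a], [a,b,c], [a,c,b]}"
    if "a \<noteq> b" "a \<noteq> c" "b \<noteq> c" for a b c :: nat
    using that
    by (subst permutations_of_set_nonempty) (simp_all add: insert_Diff_if permutations_of_set_doubleton)
  show ?thesis
    by (subst permutations_of_set_nonempty) (simp_all add: insert_Diff_if 3)
qed

text \<open>A permutation corresponds to the word of its values, which turns the generators into a
  set that can be listed.\<close>

lemma multilinear4_generators:
  "{var (\<sigma> 1) * var (\<sigma> 2) * var (\<sigma> 3) * var (\<sigma> 4) | \<sigma>. \<sigma> permutes {1, 2, 3, 4 :: nat}} =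
    (\<lambda>l. Poly_Mapping.single (Word l) (1 :: 'f::field)) ` permutations_of_set {1, 2, 3, 4}"
proof -
  have "(\<lambda>\<sigma>. map \<sigma> [1, 2, 3, 4]) ` {\<sigma>. \<sigma> permutes {1, 2, 3, 4 :: nat}} =
      permutations_of_set {1, 2, 3, 4}" (is "?f ` ?S = ?T")
  proof
    show "?f ` ?S \<subseteq> ?T"
    proof (rule image_subsetI)
      fix \<sigma> :: "nat \<Rightarrow> nat" assume "\<sigma> \<in> ?S"
      then have "\<sigma> permutes {1, 2, 3, 4}" by simp
      then have "set (map \<sigma> [1, 2, 3, 4]) = {1, 2, 3, 4}" "distinct (map \<sigma> [1, 2, 3, 4])"
        unfolding distinct_map by (simp_all only: set_map list.set permutes_image permutes_inj_on) simp
      then show "map \<sigma> [1, 2, 3, 4] \<in> ?T"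
        by (rule permutations_of_setI)
    qed
    show "?T \<subseteq> ?f ` ?S"
    proof
      fix l assume l: "l \<in> ?T"
      then have d: "distinct l" "set l = {1, 2, 3, 4}" by (auto dest: permutations_of_setD)
      have "length l = 4" using distinct_card[OF d(1)] d(2) by simp
      then obtain a b c e where abce: "l = [a, b, c, e]"
        by (auto simp: numeral_eq_Suc length_Suc_conv)
      \<comment> \<open>The identity outside the four indices, as \<open>permutes\<close>
        demands.\<close>
      define \<sigma> where "\<sigma> = id(1 := a, 2 := b, 3 := c, 4 := e)"
      have "inj_on \<sigma> {1, 2, 3, 4}" using d(1) by (auto simp: \<sigma>_def abce)
      moreover have "\<sigma> ` {1, 2, 3, 4} = {1, 2, 3, 4}" using d(2) by (simp add: \<sigma>_def abce)
      ultimately have "\<sigma> permutes {1, 2, 3, 4}"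
        by (intro bij_imp_permutes) (auto simp: bij_betw_def \<sigma>_def)
      moreover have "l = map \<sigma> [1, 2, 3, 4]" by (simp add: abce \<sigma>_def)
      ultimately show "l \<in> ?f ` ?S" by blast
    qed
  qed
  from this[symmetric] show ?thesis
    unfolding mult.assoc var_mult4 setcompr_eq_image by (simp add: image_image)
qed

text \<open>Turns membership in a span into a condition on the support: every element is the sum of
  its monomials.\<close>

lemma multilinear4_iff:
  "f \<in> multilinear4 \<longleftrightarrow> Poly_Mapping.keys f \<subseteq> Word ` permutations_of_set {1, 2, 3, 4}"
proof
  assume "f \<in> multilinear4"
  then show "Poly_Mapping.keys f \<subseteq> Word ` permutations_of_set {1, 2, 3, 4}"
    unfolding multilinear4_def multilinear4_generators
  proof (induction rule: fa.span_induct_alt)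
    case (step c g h)
    then obtain l where "l \<in> permutations_of_set {1, 2, 3, 4}" "g = Poly_Mapping.single (Word l) 1"
      by blast
    then have "Poly_Mapping.keys (fa_scale c g) \<subseteq> Word ` permutations_of_set {1, 2, 3, 4}"
      by (auto simp: in_keys_iff lookup_single when_def split: if_splits)
    then show ?case using step Poly_Mapping.keys_add[of "fa_scale c g" h] by blast
  qed simp
next
  assume *: "Poly_Mapping.keys f \<subseteq> Word ` permutations_of_set {1, 2, 3, 4}"
  have "f = (\<Sum>w\<in>Poly_Mapping.keys f. fa_scale (Poly_Mapping.lookup f w) (Poly_Mapping.single w 1))"
    by (rule poly_mapping_eqI)
      (simp add: lookup_sum lookup_single when_def if_distrib in_keys_iff cong: if_cong)
  also have "\<dots> \<in> multilinear4"
    unfolding multilinear4_def multilinear4_generators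
    by (rule fa.span_sum, rule fa.span_scale, rule fa.span_base) (use * in auto)
  finally show "f \<in> multilinear4" .
qed

text \<open>The evaluated identity acts as zero on the polynomial 1; the equation compares constant
  terms. The factor for letter \<open>i\<close> acts as \<open>q\<close> going to
  \<open>P i * (q + pderiv q)\<close>.\<close>

lemma poly_identity_coeffs:
  assumes "f \<in> multilinear4" "poly_identity weyl_scale weyl_minus_one f"
  shows "(\<Sum>l\<in>permutations_of_set {1, 2, 3, 4}. Poly_Mapping.lookup f (Word l) *
    coeff (foldr (\<lambda>i q. P i * (q + pderiv q)) l 1) 0) = 0"
proof -
  let ?a = "\<lambda>i. weyl_of_poly (P i) * weyl_y"
  have op: "weyl_op (prod_list (map ?a l)) 1 = foldr (\<lambda>i q. P i * (q + pderiv q)) l 1" for l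
    by (induction l) (simp_all add: weyl_op_one weyl_op_mult weyl_op_of_poly weyl_op_y)
  have "0 = weyl_op (eval_at weyl_scale ?a f) 1"
    using assms(2) by (simp add: poly_identity_weyl_iff weyl_op_zero)
  also have "eval_at weyl_scale ?a f = (\<Sum>w\<in>Word ` permutations_of_set {1, 2, 3, 4}.
      weyl_scale (Poly_Mapping.lookup f w) (prod_list (map ?a (letters w))))"
    using assms(1) by (intro weyl.eval_at_superset) (simp_all add: multilinear4_iff)
  also have "\<dots> = (\<Sum>l\<in>permutations_of_set {1, 2, 3, 4}.
      weyl_scale (Poly_Mapping.lookup f (Word l)) (prod_list (map ?a l)))"
    by (subst sum.reindex) (auto simp: inj_on_def)
  also have "weyl_op \<dots> 1 = (\<Sum>l\<in>permutations_of_set {1, 2, 3, 4}.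
      smult (Poly_Mapping.lookup f (Word l)) (foldr (\<lambda>i q. P i * (q + pderiv q)) l 1))"
    by (simp add: weyl_op_sum weyl_op_scale op)
  finally have "coeff 0 0 = coeff (\<Sum>l\<in>permutations_of_set {1, 2, 3, 4}.
      smult (Poly_Mapping.lookup f (Word l)) (foldr (\<lambda>i q. P i * (q + pderiv q)) l 1)) 0"
    by (rule arg_cong)
  then show ?thesis by (simp add: coeff_sum)
qed

section \<open>The nine identities\<close>

text \<open>In every differential monomial of \<open>vfield_mult3\<close> two of the three factors
  are differentiated equally often, so the alternating sum cancels.\<close>

lemma St3_vfield: "St3 (vfield p) (vfield q) (vfield r) = 0"
  unfolding St3_expand mult.assoc nf_simps
  by (rule nf_eq_0) (simp_all add: pderiv_mult pderiv_add algebra_simps)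

lemma poly_identity_St3:
  "poly_identity weyl_scale weyl_minus_one (St3 (var i) (var j) (var k :: ('x, 'f::field) free_alg))"
proof -
  have "eval_at weyl_scale a (St3 (var i) (var j) (var k :: ('x, 'f) free_alg)) =
      St3 (a i) (a j) (a k)" for a
    by (simp add: St3_expand weyl.eval_at_simps)
  then show ?thesis by (simp add: poly_identity_vfield_iff St3_vfield)
qed

text \<open>With the derivatives expanded, each coefficient of a power of \<open>y\<close> is an
  integer polynomial in the \<open>P i\<close> and their derivatives. All terms cancel formally,
  hence in every characteristic. The same method serves for \<open>Phi_lin\<close>.\<close>

lemma poly_identity_Gamma: "poly_identity weyl_scale weyl_minus_one Gamma_poly"
  unfolding poly_identity_vfield_iff Gamma_poly_def Let_def weyl.eval_at_simps mult.assoc nf_simps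
  by (intro allI, rule nf_eq_0) (simp_all only: pderiv_mult pderiv_add, algebra+)

text \<open>Each of the six terms of \<open>Phi22\<close> gives four words: 1, 2 go in either order
  to the places of its first argument, and 3, 4 to those of the second.\<close>

lemma Phi_lin_expand:
  "Phi_lin =
    (var 1 * (var 2 * (var 3 * var 4))
      + var 1 * (var 2 * (var 4 * var 3))
      + var 2 * (var 1 * (var 3 * var 4))
      + var 2 * (var 1 * (var 4 * var 3)))
    - 3 * (var 1 * (var 3 * (var 2 * var 4))
      + var 1 * (var 4 * (var 2 * var 3))
      + var 2 * (var 3 * (var 1 * var 4))
      + var 2 * (var 4 * (var 1 * var 3)))
    + 2 * (var 1 * (var 3 * (var 4 * var 2))
      + var 1 * (var 4 * (var 3 * var 2))
      + var 2 * (var 3 * (var 4 * var 1))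
      + var 2 * (var 4 * (var 3 * var 1)))
    + 2 * (var 3 * (var 1 * (var 2 * var 4))
      + var 3 * (var 2 * (var 1 * var 4))
      + var 4 * (var 1 * (var 2 * var 3))
      + var 4 * (var 2 * (var 1 * var 3)))
    - 3 * (var 3 * (var 1 * (var 4 * var 2))
      + var 3 * (var 2 * (var 4 * var 1))
      + var 4 * (var 1 * (var 3 * var 2))
      + var 4 * (var 2 * (var 3 * var 1)))
    + (var 3 * (var 4 * (var 1 * var 2))
      + var 3 * (var 4 * (var 2 * var 1))
      + var 4 * (var 3 * (var 1 * var 2))
      + var 4 * (var 3 * (var 2 * var 1)))"
  unfolding Phi_lin_def Phi22_def power2_eq_square
  by (simp only: distrib_left distrib_right mult.assoc multidegree_component_add
      multidegree_component_diff multidegree_component_numeral multidegree_component_var4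
      count_list_multilinear4_iff)
    (simp add: algebra_simps)

lemma poly_identity_Phi: "poly_identity weyl_scale weyl_minus_one Phi_lin"
  unfolding poly_identity_vfield_iff Phi_lin_expand weyl.eval_at_simps mult.assoc nf_simps
  by (intro allI, rule nf_eq_0) (simp_all only: pderiv_mult pderiv_add, algebra+)

section \<open>The linear conditions on an identity\<close>

text \<open>The words at which the nine claimed basis elements have an invertible coefficient matrix.\<close>

definition pivot_words :: "nat list set" where
  "pivot_words = {[1,2,3,4], [1,2,4,3], [1,3,4,2], [1,4,2,3], [1,4,3,2],
     [2,1,4,3], [3,4,1,2], [4,1,2,3], [4,3,2,1]}"

text \<open>Reading coefficients at the pivot words is injective on identities, which bounds their
  dimension by nine and later gives the spanning property.\<close>

lemma poly_identity_eq_0: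
  fixes f :: "(nat, 'f::field) free_alg"
  assumes two: "(2 :: 'f) \<noteq> 0"
    and f: "f \<in> multilinear4" "poly_identity weyl_scale weyl_minus_one f"
    and zero: "\<And>l. l \<in> pivot_words \<Longrightarrow> Poly_Mapping.lookup f (Word l) = 0"
  shows "f = 0"
proof -
  define c where "c l = Poly_Mapping.lookup f (Word l)" for l
  have zero: "c [1,2,3,4] = 0" "c [1,2,4,3] = 0" "c [1,3,4,2] = 0" "c [1,4,2,3] = 0"
    "c [1,4,3,2] = 0" "c [2,1,4,3] = 0" "c [3,4,1,2] = 0" "c [4,1,2,3] = 0" "c [4,3,2,1] = 0"
    by (simp_all add: c_def zero pivot_words_def)
  have coeffs: "(\<Sum>l\<in>permutations_of_set {1, 2, 3, 4}.
      c l * coeff (foldr (\<lambda>i q. P i * (q + pderiv q)) l 1) 0) = 0" for P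
    unfolding c_def by (rule poly_identity_coeffs[OF f])
  note coeffs = coeffs[unfolded permutations_1234]
  note simps = zero pderiv_pCons one_pCons algebra_simps
  \<comment> \<open>The digits \<open>k1 k2 k3 k4\<close> in the fact names below record the evaluation \<open>xi \<mapsto> x^ki y\<close>.\<close>
  let ?P = "\<lambda>p1 p2 p3 p4 :: 'f poly. (\<lambda>_. 0)(1 := p1, 2 := p2, 3 := p3, 4 := p4)"
  \<comment> \<open>In each equation a word is weighted by the product of the ki! times the number
    of ways to give every letter i a set of ki earlier letters, all sets disjoint: these are the
    letters whose derivative hits x^ki. A word whose first letter has ki > 0 drops out.\<close>
  have e0111: "c [1,3,2,4] = 0"
    using coeffs[of "?P 1 [:0, 1:] [:0, 1:] [:0, 1:]"] by (simp add: simps del: One_nat_def)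
  \<comment> \<open>The factor 2 is the second derivative of x^2; it appears in every substitution
    with a digit 2 and is cancelled by \<open>two\<close>.\<close>
  have "2 * (c [2,1,3,4] + c [2,4,1,3]) = 0"
    using coeffs[of "?P 1 1 [:0, 0, 1:] [:0, 1:]"] by (simp add: simps del: One_nat_def)
  then have e0021: "c [2,1,3,4] + c [2,4,1,3] = 0"
    using two by (simp only: mult_eq_0_iff simp_thms)
  have "2 * (c [1,3,2,4] + 2 * c [2,1,3,4] + c [2,3,1,4]) = 0"
    using coeffs[of "?P 1 1 [:0, 1:] [:0, 0, 1:]"] by (simp add: simps del: One_nat_def)
  then have e0012: "c [1,3,2,4] + 2 * c [2,1,3,4] + c [2,3,1,4] = 0"
    using two by (simp only: mult_eq_0_iff simp_thms)
  have "2 * (c [1,3,2,4] + c [3,1,2,4] + 2 * c [3,1,4,2]) = 0"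
    using coeffs[of "?P 1 [:0, 0, 1:] 1 [:0, 1:]"] by (simp add: simps del: One_nat_def)
  then have e0201: "c [1,3,2,4] + c [3,1,2,4] + 2 * c [3,1,4,2] = 0"
    using two by (simp only: mult_eq_0_iff simp_thms)
  have "2 * (2 * c [1,3,2,4] + 2 * c [3,1,2,4] + c [3,1,4,2] + c [3,2,1,4]) = 0"
    using coeffs[of "?P 1 [:0, 1:] 1 [:0, 0, 1:]"] by (simp add: simps del: One_nat_def)
  then have e0102: "2 * c [1,3,2,4] + 2 * c [3,1,2,4] + c [3,1,4,2] + c [3,2,1,4] = 0"
    using two by (simp only: mult_eq_0_iff simp_thms)
  have e1011: "c [2,1,3,4] + c [2,3,1,4] + c [2,3,4,1] + c [2,4,1,3] + c [2,4,3,1] = 0"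
    using coeffs[of "?P [:0, 1:] 1 [:0, 1:] [:0, 1:]"] by (simp add: simps del: One_nat_def)
  have e1101: "c [3,1,2,4] + c [3,1,4,2] + c [3,2,1,4] + c [3,2,4,1] + c [3,4,2,1] = 0"
    using coeffs[of "?P [:0, 1:] [:0, 1:] 1 [:0, 1:]"] by (simp add: simps del: One_nat_def)
  have "2 * (c [4,1,3,2] + c [4,2,1,3]) = 0"
    using coeffs[of "?P 1 [:0, 1:] [:0, 0, 1:] 1"] by (simp add: simps del: One_nat_def)
  then have e0120: "c [4,1,3,2] + c [4,2,1,3] = 0"
    using two by (simp only: mult_eq_0_iff simp_thms)
  have "2 * (2 * c [4,1,3,2] + c [4,3,1,2]) = 0"
    using coeffs[of "?P 1 [:0, 0, 1:] [:0, 1:] 1"] by (simp add: simps del: One_nat_def)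
  then have e0210: "2 * c [4,1,3,2] + c [4,3,1,2] = 0"
    using two by (simp only: mult_eq_0_iff simp_thms)
  have e1110: "c [4,1,3,2] + c [4,2,1,3] + c [4,2,3,1] + c [4,3,1,2] = 0"
    using coeffs[of "?P [:0, 1:] [:0, 1:] [:0, 1:] 1"] by (simp add: simps del: One_nat_def)
  have "2 * (2 * c [2,4,1,3] + c [2,4,3,1] + 2 * c [4,2,1,3] + c [4,2,3,1]) = 0"
    using coeffs[of "?P [:0, 1:] 1 [:0, 0, 1:] 1"] by (simp add: simps del: One_nat_def)
  then have e1020: "2 * c [2,4,1,3] + c [2,4,3,1] + 2 * c [4,2,1,3] + c [4,2,3,1] = 0"
    using two by (simp only: mult_eq_0_iff simp_thms)
  have "2 * (c [3,1,4,2] + c [3,4,2,1] + c [4,1,3,2] + 2 * c [4,3,1,2]) = 0"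
    using coeffs[of "?P [:0, 1:] [:0, 0, 1:] 1 1"] by (simp add: simps del: One_nat_def)
  then have e1200: "c [3,1,4,2] + c [3,4,2,1] + c [4,1,3,2] + 2 * c [4,3,1,2] = 0"
    using two by (simp only: mult_eq_0_iff simp_thms)
  have e0010:
    "c [1,3,2,4] + 2 * c [2,1,3,4] + c [2,3,1,4] + c [2,3,4,1] + 3 * c [2,4,1,3] + 2 * c
      [2,4,3,1] + 2 * c [4,1,3,2] + 3 * c [4,2,1,3] + 2 * c [4,2,3,1] + c [4,3,1,2]
      = 0"
    using coeffs[of "?P 1 1 [:0, 1:] 1"] by (simp add: simps del: One_nat_def)
  have e0100:
    "2 * c [1,3,2,4] + 2 * c [3,1,2,4] + 3 * c [3,1,4,2] + c [3,2,1,4] + c [3,2,4,1] + 2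
      * c [3,4,2,1] + 3 * c [4,1,3,2] + c [4,2,1,3] + c [4,2,3,1] + 3 * c [4,3,1,2]
      = 0"
    using coeffs[of "?P 1 [:0, 1:] 1 1"] by (simp add: simps del: One_nat_def)
  have e0001:
    "3 * c [1,3,2,4] + 3 * c [2,1,3,4] + 3 * c [2,3,1,4] + 2 * c [2,3,4,1] + c [2,4,1,3]
      + c [2,4,3,1] + 3 * c [3,1,2,4] + 2 * c [3,1,4,2] + 3 * c [3,2,1,4] + 2 * c
      [3,2,4,1] + c [3,4,2,1] = 0"
    using coeffs[of "?P 1 1 1 [:0, 1:]"] by (simp add: simps del: One_nat_def)
  \<comment> \<open>The facts \<open>cN\<close> number the words in lexicographic order, starting from 0.\<close>
  define u v t where uvt: "u = c [2,4,1,3]" "v = c [3,1,4,2]" "t = c [4,1,3,2]"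
  \<comment> \<open>The twelve equations of total degree three express twelve of the fifteen
    unknowns through \<open>u\<close>, \<open>v\<close>, \<open>t\<close>. Each is solved for an
    unknown with coefficient 1, so nothing has to be divided.\<close>
  have c2: "c [1,3,2,4] = 0" by (fact e0111)
  have c6: "c [2,1,3,4] = - u"
    using e0021 unfolding uvt[symmetric] by algebra
  have c8: "c [2,3,1,4] = 2 * u"
    using e0012 c2 c6 unfolding uvt[symmetric] by algebra
  have c12: "c [3,1,2,4] = - 2 * v"
    using e0201 c2 unfolding uvt[symmetric] by algebra
  have c14: "c [3,2,1,4] = 3 * v"
    using e0102 c2 c12 unfolding uvt[symmetric] by algebra
  have c20: "c [4,2,1,3] = - t"
    using e0120 unfolding uvt[symmetric] by algebra
  have c22: "c [4,3,1,2] = - 2 * t"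
    using e0210 unfolding uvt[symmetric] by algebra
  have c21: "c [4,2,3,1] = 2 * t"
    using e1110 c20 c22 unfolding uvt[symmetric] by algebra
  have c11: "c [2,4,3,1] = - 2 * u"
    using e1020 c20 c21 unfolding uvt[symmetric] by algebra
  have c9: "c [2,3,4,1] = 0"
    using e1011 c6 c8 c11 unfolding uvt[symmetric] by algebra
  have c17: "c [3,4,2,1] = 3 * t - v"
    using e1200 c22 unfolding uvt[symmetric] by algebra
  have c15: "c [3,2,4,1] = - v - 3 * t"
    using e1101 c12 c14 c17 unfolding uvt[symmetric] by algebra
  \<comment> \<open>The three equations of total degree one now become t - u = 0, t - v = 0 and 2u +
    2v - 3t = 0; together they give t = 0 in every characteristic.\<close>
  have u: "u = t"
    using e0010 c2 c6 c8 c9 c11 c20 c21 c22 unfolding uvt[symmetric] by algebra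
  have v: "v = t"
    using e0100 c2 c12 c14 c15 c17 c20 c21 c22 unfolding uvt[symmetric] by algebra
  have t: "t = 0"
    using e0001 c2 c6 c8 c9 c11 c12 c14 c15 c17 u v unfolding uvt[symmetric] by algebra
  have c_eq_0: "c l = 0" if "l \<in> permutations_of_set {1, 2, 3, 4}" for l
    using that unfolding permutations_1234
    by (auto simp: zero u v t c2 c6 c8 c9 c11 c12 c14 c15 c17 c20 c21 c22
        simp flip: uvt simp del: One_nat_def)
  have "w \<notin> Poly_Mapping.keys f" for w
  proof
    assume w: "w \<in> Poly_Mapping.keys f"
    then obtain l where "l \<in> permutations_of_set {1, 2, 3, 4}" "w = Word l"
      using f(1) unfolding multilinear4_iff by blast
    with c_eq_0 w show False by (simp add: c_def in_keys_iff)
  qed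
  then have "Poly_Mapping.keys f = {}" by blast
  then show ?thesis by simp
qed

section \<open>The basis\<close>

lemma lookup_numeral_mult:
  "Poly_Mapping.lookup (numeral n * f) w = numeral n * Poly_Mapping.lookup f (w :: 'x word)"
proof (induction n)
  case (Bit0 n)
  then show ?case by (simp only: numeral.simps distrib_right lookup_add)
next
  case (Bit1 n)
  then show ?case by (simp only: numeral.simps distrib_right lookup_add mult_1_left)
qed simp

definition identity_basis :: "(nat, 'f::field) free_alg list" where
  "identity_basis =
     [Gamma_poly, Phi_lin,
      var 1 * St3 (var 2) (var 3) (var 4),
      var 2 * St3 (var 1) (var 3) (var 4),
      var 3 * St3 (var 1) (var 2) (var 4),
      var 4 * St3 (var 1) (var 2) (var 3),
      St3 (var 2) (var 3) (var 4) * var 1,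
      St3 (var 1) (var 3) (var 4) * var 2,
      St3 (var 1) (var 2) (var 4) * var 3]"

lemma length_identity_basis: "length identity_basis = 9"
  by (simp add: identity_basis_def)

section \<open>The nine elements are multilinear identities\<close>

lemma multilinear4_zero: "0 \<in> multilinear4"
  unfolding multilinear4_def by (rule fa.span_zero)

lemma multilinear4_add: "f \<in> multilinear4 \<Longrightarrow> g \<in> multilinear4 \<Longrightarrow> f + g \<in> multilinear4"
  unfolding multilinear4_def by (rule fa.span_add)

lemma multilinear4_scale: "f \<in> multilinear4 \<Longrightarrow> fa_scale c f \<in> multilinear4"
  unfolding multilinear4_def by (rule fa.span_scale)

lemma multilinear4_diff: "f \<in> multilinear4 \<Longrightarrow> g \<in> multilinear4 \<Longrightarrow> f - g \<in> multilinear4"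
  unfolding multilinear4_def by (rule fa.span_diff)

lemma multilinear4_uminus: "f \<in> multilinear4 \<Longrightarrow> - f \<in> multilinear4"
  unfolding multilinear4_def by (rule fa.span_neg)

lemma multilinear4_numeral_mult: "f \<in> multilinear4 \<Longrightarrow> numeral n * f \<in> multilinear4"
  using multilinear4_scale[of f "numeral n"]
  by (simp add: poly_mapping_eqI[of "fa_scale (numeral n) f" "numeral n * f"] lookup_numeral_mult)

lemma multilinear4_monomial:
  "[i, j, k, l] \<in> permutations_of_set {1, 2, 3, 4} \<Longrightarrow>
    var i * (var j * (var k * var l)) \<in> multilinear4"
  unfolding multilinear4_def multilinear4_generators var_mult4 by (intro fa.span_base imageI)

text \<open>Sums are distributed only over factors \<open>var _\<close>, so a numeral keeps
  multiplying its whole group of words and \<open>multilinear4_numeral_mult\<close> applies.\<close>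

lemma identity_basis_multilinear4: "set identity_basis \<subseteq> multilinear4"
  unfolding identity_basis_def list.set Gamma_poly_def Let_def Phi_lin_expand St3_expand
    distrib_left[of "var _"] distrib_right[of _ _ "var _"] left_diff_distrib right_diff_distrib
    mult.assoc
  by (intro insert_subsetI empty_subsetI multilinear4_add multilinear4_diff multilinear4_uminus
      multilinear4_numeral_mult multilinear4_monomial; unfold permutations_1234; simp)

lemma identity_basis_poly_identity:
  "f \<in> set identity_basis \<Longrightarrow> poly_identity weyl_scale weyl_minus_one f"
  by (auto simp: identity_basis_def poly_identity_Gamma poly_identity_Phi
      intro: poly_identity_mult_left poly_identity_mult_right poly_identity_St3)

section \<open>The coefficient matrix at the pivot words\<close>

definition identity_basis_comb :: "(nat \<Rightarrow> 'f::field) \<Rightarrow> (nat, 'f) free_alg" where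
  "identity_basis_comb b = (\<Sum>i<9. fa_scale (b i) (identity_basis ! i))"

text \<open>The rows of a 9 by 9 integer matrix with determinant 2 up to sign. It serves twice: for
  independence and for solving for the coordinates of a given identity.\<close>

lemma lookup_identity_basis_comb:
  "Poly_Mapping.lookup (identity_basis_comb b) (Word [1,2,3,4]) = - b 0 + b 1 + b 2"
  "Poly_Mapping.lookup (identity_basis_comb b) (Word [1,2,4,3]) = 2 * b 0 + b 1 - b 2 + b 8"
  "Poly_Mapping.lookup (identity_basis_comb b) (Word [1,3,4,2]) = b 0 + 2 * b 1 + b 2 + b 7"
  "Poly_Mapping.lookup (identity_basis_comb b) (Word [1,4,2,3]) = - 2 * b 0 - 3 * b 1 + b 2 - b 8"
  "Poly_Mapping.lookup (identity_basis_comb b) (Word [1,4,3,2]) = 2 * b 1 - b 2 - b 7"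
  "Poly_Mapping.lookup (identity_basis_comb b) (Word [2,1,4,3]) = - 2 * b 0 + b 1 - b 3 - b 8"
  "Poly_Mapping.lookup (identity_basis_comb b) (Word [3,4,1,2]) = b 0 + b 1 + b 4 + b 7"
  "Poly_Mapping.lookup (identity_basis_comb b) (Word [4,1,2,3]) = b 0 + 2 * b 1 + b 5 + b 8"
  "Poly_Mapping.lookup (identity_basis_comb b) (Word [4,3,2,1]) = b 1 - b 5 - b 6"
proof -
  have 9: "{..<9 :: nat} = {0,1,2,3,4,5,6,7,8}" by auto
  show
    "Poly_Mapping.lookup (identity_basis_comb b) (Word [1,2,3,4]) = - b 0 + b 1 + b 2"
    "Poly_Mapping.lookup (identity_basis_comb b) (Word [1,2,4,3]) = 2 * b 0 + b 1 - b 2 + b 8"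
    "Poly_Mapping.lookup (identity_basis_comb b) (Word [1,3,4,2]) = b 0 + 2 * b 1 + b 2 + b 7"
    "Poly_Mapping.lookup (identity_basis_comb b) (Word [1,4,2,3]) = - 2 * b 0 - 3 * b 1 + b 2 - b 8"
    "Poly_Mapping.lookup (identity_basis_comb b) (Word [1,4,3,2]) = 2 * b 1 - b 2 - b 7"
    "Poly_Mapping.lookup (identity_basis_comb b) (Word [2,1,4,3]) = - 2 * b 0 + b 1 - b 3 - b 8"
    "Poly_Mapping.lookup (identity_basis_comb b) (Word [3,4,1,2]) = b 0 + b 1 + b 4 + b 7"
    "Poly_Mapping.lookup (identity_basis_comb b) (Word [4,1,2,3]) = b 0 + 2 * b 1 + b 5 + b 8"
    "Poly_Mapping.lookup (identity_basis_comb b) (Word [4,3,2,1]) = b 1 - b 5 - b 6"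
    unfolding identity_basis_comb_def 9
    by (simp_all add: identity_basis_def Gamma_poly_def Phi_lin_expand St3_expand
        distrib_left distrib_right left_diff_distrib right_diff_distrib mult.assoc var_mult4 lookup_add lookup_minus
        lookup_numeral_mult lookup_single when_def)
qed

text \<open>Indexing coefficients by positions lets one computation give both conclusions: a
  repeated entry would itself yield a nontrivial relation.\<close>

lemma (in vector_space) independent_listI:
  assumes "\<And>c i. (\<Sum>i<length xs. scale (c i) (xs ! i)) = 0 \<Longrightarrow> i < length xs \<Longrightarrow> c i = 0"
  shows "distinct xs \<and> independent (set xs)"
proof
  show d: "distinct xs"
    unfolding distinct_conv_nth
  proof (intro allI impI notI)
    fix i j assume ij: "i < length xs" "j < length xs" "i \<noteq> j" "xs ! i = xs ! j"
    \<comment> \<open>The relation \<open>xs ! i - xs ! j = 0\<close>, with coefficient 1 at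
      \<open>i\<close>.\<close>
    define c :: "nat \<Rightarrow> 'a" where "c k = (if k = i then 1 else 0) - (if k = j then 1 else 0)" for k
    have "(\<Sum>k<length xs. scale (c k) (xs ! k)) =
        (\<Sum>k<length xs. if k = i then xs ! k else 0) - (\<Sum>k<length xs. if k = j then xs ! k else 0)"
      unfolding sum_subtractf[symmetric] by (rule sum.cong) (auto simp: c_def scale_left_diff_distrib)
    also have "\<dots> = 0" using ij by (simp add: sum.delta)
    finally have "c i = 0" using ij(1) by (rule assms)
    then show False using ij(3) by (simp add: c_def)
  qed
  show "independent (set xs)"
  proof
    assume "dependent (set xs)"
    then obtain u v where uv: "v \<in> set xs" "u v \<noteq> 0" "(\<Sum>v\<in>set xs. scale (u v) v) = 0"
      using dependent_finite[of "set xs"] by auto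
    have "(\<Sum>i<length xs. scale (u (xs ! i)) (xs ! i)) = (\<Sum>v\<in>set xs. scale (u v) v)"
      by (rule sum.reindex_bij_betw) (use d in \<open>simp add: bij_betw_nth\<close>)
    then show False
      using assms[of "\<lambda>i. u (xs ! i)"] uv by (auto simp: in_set_conv_nth)
  qed
qed

text \<open>Otherwise the characteristic divides the prime 2, and it cannot be 1 because 0 and 1
  differ in a field.\<close>

lemma two_neq_zero_if_CHAR:
  assumes "CHAR('a::field) \<noteq> 2"
  shows "(2 :: 'a) \<noteq> 0"
proof
  assume "(2 :: 'a) = 0"
  then have "of_nat 2 = (0 :: 'a)" by simp
  then have "CHAR('a) dvd 2" by (simp only: of_nat_eq_0_iff_char_dvd)
  then have "CHAR('a) = 1" using assms two_is_prime_nat by (auto simp: prime_nat_iff)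
  then show False by simp
qed

theorem proposition4p3:
  assumes "infinite (UNIV :: 'f::field set)"
    and "CHAR('f) \<noteq> 2"
  shows
    "let B :: (nat, 'f) free_alg list =
       [Gamma_poly, Phi_lin,
        var 1 * St3 (var 2) (var 3) (var 4),
        var 2 * St3 (var 1) (var 3) (var 4),
        var 3 * St3 (var 1) (var 2) (var 4),
        var 4 * St3 (var 1) (var 2) (var 3),
        St3 (var 2) (var 3) (var 4) * var 1,
        St3 (var 1) (var 3) (var 4) * var 2,
        St3 (var 1) (var 2) (var 4) * var 3]
     in distinct B \<and> fa.independent (set B) \<and>
        fa.span (set B) = {f \<in> multilinear4. poly_identity weyl_scale weyl_minus_one f}"
  unfolding Let_def identity_basis_def[symmetric]
proof -
  note two = two_neq_zero_if_CHAR[OF assms(2)]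
  let ?B = "identity_basis :: (nat, 'f) free_alg list"
  let ?R = "{f \<in> multilinear4 :: (nat, 'f) free_alg set. poly_identity weyl_scale weyl_minus_one f}"
  have "distinct ?B \<and> fa.independent (set ?B)"
  proof (rule fa.independent_listI)
    fix b :: "nat \<Rightarrow> 'f" and i
    assume "(\<Sum>i<length ?B. fa_scale (b i) (?B ! i)) = 0"
      and i: "i < length ?B"
    then have "identity_basis_comb b = 0" by (simp add: identity_basis_comb_def length_identity_basis)
    note eqs = lookup_identity_basis_comb[of b, unfolded this lookup_zero, symmetric]
    \<comment> \<open>The sum of these two rows is -2 times \<open>b 1\<close>.\<close>
    have "2 * b 1 = 0" using eqs(2,4) by algebra
    then have 1: "b 1 = 0" using two by simp
    \<comment> \<open>The sum of these two rows is \<open>b 0 + 4 * b 1\<close>; the remaining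
      system is triangular in the order followed below.\<close>
    have 0: "b 0 = 0" using eqs(3,5) 1 by algebra
    have 2: "b 2 = 0" using eqs(1) 0 1 by algebra
    have 8: "b 8 = 0" using eqs(2) 0 1 2 by algebra
    have 7: "b 7 = 0" using eqs(3) 0 1 2 by algebra
    have 3: "b 3 = 0" using eqs(6) 0 1 8 by algebra
    have 4: "b 4 = 0" using eqs(7) 0 1 7 by algebra
    have 5: "b 5 = 0" using eqs(8) 0 1 8 by algebra
    have 6: "b 6 = 0" using eqs(9) 1 5 by algebra
    have "i \<in> {0,1,2,3,4,5,6,7,8}" using i unfolding length_identity_basis by auto
    then show "b i = 0" using 0 1 2 3 4 5 6 7 8 by blast
  qed
  moreover have "fa.span (set ?B) = ?R" (is "?L = _")
  proof
    have "fa.subspace ?R"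
      by (rule fa.subspaceI) (auto simp: multilinear4_add multilinear4_scale poly_identity_add
          poly_identity_scale poly_identity_zero multilinear4_zero)
    then show "?L \<subseteq> ?R"
      using identity_basis_multilinear4 identity_basis_poly_identity by (intro fa.span_minimal) auto
    show "?R \<subseteq> ?L"
    proof
      fix f :: "(nat, 'f) free_alg" assume "f \<in> ?R"
      then have f: "f \<in> multilinear4" "poly_identity weyl_scale weyl_minus_one f" by auto
      define c where "c l = Poly_Mapping.lookup f (Word l)" for l
      \<comment> \<open>The unique solution of the equations in \<open>lookup_identity_basis_comb\<close>.\<close>
      define b1 where "b1 = - (c [1,2,4,3] + c [1,4,2,3]) / 2"
      define b0 where "b0 = c [1,3,4,2] + c [1,4,3,2] - 4 * b1"
      define b2 where "b2 = c [1,2,3,4] + b0 - b1"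
      define b8 where "b8 = c [1,2,4,3] - 2 * b0 - b1 + b2"
      define b7 where "b7 = c [1,3,4,2] - b0 - 2 * b1 - b2"
      define b3 where "b3 = - 2 * b0 + b1 - b8 - c [2,1,4,3]"
      define b4 where "b4 = c [3,4,1,2] - b0 - b1 - b7"
      define b5 where "b5 = c [4,1,2,3] - b0 - 2 * b1 - b8"
      define b6 where "b6 = b1 - b5 - c [4,3,2,1]"
      note defs = b0_def b2_def b8_def b7_def b3_def b4_def b5_def b6_def
      define b where "b i = [b0, b1, b2, b3, b4, b5, b6, b7, b8] ! i" for i
      have span: "identity_basis_comb b \<in> ?L"
        unfolding identity_basis_comb_def
        by (intro fa.span_sum fa.span_scale fa.span_base) (simp add: length_identity_basis nth_mem)
      with \<open>?L \<subseteq> ?R\<close> have "identity_basis_comb b \<in> ?R" by blast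
      \<comment> \<open>The difference is an identity; once it is shown to vanish at all pivot
        words, \<open>poly_identity_eq_0\<close> makes it zero.\<close>
      then have g: "f - identity_basis_comb b \<in> multilinear4"
        "poly_identity weyl_scale weyl_minus_one (f - identity_basis_comb b)"
        using f by (auto simp: multilinear4_diff poly_identity_def weyl.eval_at_diff)
      \<comment> \<open>The only division, cleared of its denominator; elsewhere \<open>b1\<close>
        is treated as an indeterminate.\<close>
      have b1: "2 * b1 = - (c [1,2,4,3] + c [1,4,2,3])"
        using two by (simp add: b1_def)
      have bs: "b 0 = b0" "b 1 = b1" "b 2 = b2" "b 3 = b3" "b 4 = b4" "b 5 = b5" "b 6 = b6"
        "b 7 = b7" "b 8 = b8"
        by (simp_all add: b_def)
      have "c l = Poly_Mapping.lookup (identity_basis_comb b) (Word l)" if "l \<in> pivot_words" for l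
        using that unfolding pivot_words_def
      proof (elim insertE emptyE)
        \<comment> \<open>This is the one row that depends on the value of \<open>b1\<close>; the
          others hold by the choice of the remaining coordinates.\<close>
        assume l: "l = [1,4,2,3]"
        show ?thesis
          using b1 unfolding l lookup_identity_basis_comb bs defs by algebra
      qed (simp_all only: lookup_identity_basis_comb bs defs, simp_all add: algebra_simps)
      then have "f - identity_basis_comb b = 0"
        by (intro poly_identity_eq_0[OF two g]) (simp add: lookup_minus c_def)
      then show "f \<in> ?L" using span by simp
    qed
  qed
  ultimately show "distinct ?B \<and> fa.independent (set ?B) \<and> fa.span (set ?B) = ?R"
    by blast
qed

end
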